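(* If a regular cardinal $\kappa>2^{\aleph_1}$ carries a uniform indecomposable ultrafilter, then every $\kappa$-Aronszajn tree admits an $\omega$-ascent path.
   Context: An ultrafilter $U$ over $\kappa$ is uniform if all its members have size $\kappa$; it is $\mu$-indecomposable if for every $f:\kappa\to\mu$ there is $H\subseteq\mu$ with $|H|<\mu$ and $f^{-1}[H]\in U$; it is indecomposable if it is $\mu$-indecomposable for all cardinals $\mu\in[\aleph_1,\kappa)$. For a tree $(T,<_T)$ of height $\kappa$ with levels $T_\alpha$, an $\omega$-ascent path is a sequence $\langle f_\alpha\mid\alpha<\kappa\rangle$ with $f_\alpha:\omega\to T_\alpha$ such that for all $\alpha<\beta<\kappa$, the set $\{i<\omega\mid f_\alpha(i)<_T f_\beta(i)\}$ contains a tail of $\omega$ (i.e., is cofinite). *)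

theory Defs
  imports Main
begin

text \<open>Cardinals are represented by cardinal well-orders (Main's BNF cardinal library).
  The regular cardinal kappa is a cardinal order r; the ordinals below kappa are
  the elements of Field r, ordered by r.\<close>

definition ultrafilter_on :: "'a set \<Rightarrow> 'a set set \<Rightarrow> bool" where
  "ultrafilter_on A U \<longleftrightarrow>
     U \<subseteq> Pow A \<and> A \<in> U \<and> {} \<notin> U \<and>
     (\<forall>X\<in>U. \<forall>Y\<in>U. X \<inter> Y \<in> U) \<and>
     (\<forall>X\<in>U. \<forall>Y. X \<subseteq> Y \<and> Y \<subseteq> A \<longrightarrow> Y \<in> U) \<and>
     (\<forall>X. X \<subseteq> A \<longrightarrow> X \<in> U \<or> A - X \<in> U)"

definition uniform_uf :: "'k rel \<Rightarrow> 'k set set \<Rightarrow> bool" where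
  "uniform_uf r U \<longleftrightarrow> ultrafilter_on (Field r) U \<and> (\<forall>X\<in>U. (card_of X, r) \<in> ordIso)"

text \<open>mu-indecomposability; the cardinal mu is represented by a set M of size mu.\<close>
definition indecomposable_for :: "'k rel \<Rightarrow> 'k set set \<Rightarrow> 'm set \<Rightarrow> bool" where
  "indecomposable_for r U M \<longleftrightarrow>
     (\<forall>f. f ` Field r \<subseteq> M \<longrightarrow>
        (\<exists>H. H \<subseteq> M \<and> (card_of H, card_of M) \<in> ordLess \<and> {x \<in> Field r. f x \<in> H} \<in> U))"

text \<open>Indecomposable: mu-indecomposable for every cardinal mu with aleph_1 \<le> mu < kappa.
  Every such cardinal is the cardinality of some subset of Field r, so it suffices
  (and is equivalent) to let M range over subsets of Field r.\<close>
definition indecomposable_uf :: "'k rel \<Rightarrow> 'k set set \<Rightarrow> bool" where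
  "indecomposable_uf r U \<longleftrightarrow>
     (\<forall>M. M \<subseteq> Field r \<and> (cardSuc natLeq, card_of M) \<in> ordLeq \<and> (card_of M, r) \<in> ordLess
          \<longrightarrow> indecomposable_for r U M)"

definition predS :: "'t rel \<Rightarrow> 't \<Rightarrow> 't set" where
  "predS R t = {s. (s, t) \<in> R \<and> s \<noteq> t}"

definition is_tree :: "'t set \<Rightarrow> 't rel \<Rightarrow> bool" where
  "is_tree T R \<longleftrightarrow> partial_order_on T R \<and> (\<forall>t\<in>T. Well_order (Restr R (predS R t)))"

definition tree_level :: "'t set \<Rightarrow> 't rel \<Rightarrow> 'k rel \<Rightarrow> 'k \<Rightarrow> 't set" where
  "tree_level T R r \<alpha> = {t \<in> T. (Restr R (predS R t), Restr r (underS r \<alpha>)) \<in> ordIso}"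

definition aronszajn_tree :: "'k rel \<Rightarrow> 't set \<Rightarrow> 't rel \<Rightarrow> bool" where
  "aronszajn_tree r T R \<longleftrightarrow>
     is_tree T R \<and>
     (\<forall>\<alpha>\<in>Field r. tree_level T R r \<alpha> \<noteq> {}) \<and>
     (\<forall>t\<in>T. \<exists>\<alpha>\<in>Field r. t \<in> tree_level T R r \<alpha>) \<and>
     (\<forall>\<alpha>\<in>Field r. (card_of (tree_level T R r \<alpha>), r) \<in> ordLess) \<and>
     \<not> (\<exists>B. B \<subseteq> T \<and> (\<forall>x\<in>B. \<forall>y\<in>B. (x, y) \<in> R \<or> (y, x) \<in> R) \<and>
            (\<forall>\<alpha>\<in>Field r. B \<inter> tree_level T R r \<alpha> \<noteq> {}))"

definition omega_ascent_path :: "'k rel \<Rightarrow> 't set \<Rightarrow> 't rel \<Rightarrow> ('k \<Rightarrow> nat \<Rightarrow> 't) \<Rightarrow> bool" where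
  "omega_ascent_path r T R f \<longleftrightarrow>
     (\<forall>\<alpha>\<in>Field r. \<forall>i. f \<alpha> i \<in> tree_level T R r \<alpha>) \<and>
     (\<forall>\<alpha>\<in>Field r. \<forall>\<beta>\<in>Field r. (\<alpha>, \<beta>) \<in> r \<and> \<alpha> \<noteq> \<beta> \<longrightarrow>
        finite {i. \<not> ((f \<alpha> i, f \<beta> i) \<in> R \<and> f \<alpha> i \<noteq> f \<beta> i)})"

end

theory Submission
  imports Defs "HOL-Library.Countable_Set"
begin

text \<open>
  Indecomposability and \<open>\<kappa> > 2\<^sup>\<aleph>\<^sup>1\<close> yield, by an argument of Silver, a map \<open>\<phi>\<close> from \<open>\<kappa>\<close> to \<open>\<omega>\<close>
  through which every map on \<open>\<kappa>\<close> with fewer than \<open>\<kappa>\<close> values factors modulo \<open>U\<close>. Fix a node \<open>t x\<close>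
  on every level \<open>x\<close>. Factoring the map that sends \<open>x\<close> to the predecessor of \<open>t x\<close> on level \<open>a\<close> gives
  \<open>g a : \<omega> \<rightarrow> T\<^sub>a\<close>, and the set \<open>X a c\<close> of all \<open>i\<close> with \<open>g a i < g c i\<close> belongs to the ultrafilter
  \<open>W = \<phi>\<^sub>*U\<close> whenever \<open>a < c\<close>.

  To pass from \<open>W\<close> to the cofinite filter, factor \<open>X a\<close> itself as \<open>X a c = Y a (\<phi> c)\<close> for almost
  all \<open>c\<close>. There are at most \<open>2\<^sup>\<omega>\<close> sequences \<open>Y a\<close> of sets in \<open>W\<close>, so by regularity one sequence \<open>Z\<close>
  occurs for unboundedly many \<open>a\<close>. For two such levels \<open>a < b\<close>, a common bound \<open>c\<close> shows that
  \<open>g a i < g b i\<close> for all \<open>i \<in> Z n\<close>, where \<open>n = \<phi> c\<close>. Hence choosing \<open>y m\<close> in \<open>Z 0 \<inter> \<dots> \<inter> Z m\<close>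
  turns \<open>m \<mapsto> g a (y m)\<close> into an ascent path along these levels, which projects to all levels.
\<close>

unbundle cardinal_syntax

section \<open>Restricting nodes of a tree to lower levels\<close>

lemma predS_subset:
  assumes "is_tree T R" and "(s, t) \<in> R"
  shows "predS R s \<subseteq> predS R t"
proof -
  have "trans R" "antisym R"
    using assms(1) by (auto simp: is_tree_def dest: partial_order_onD)
  with assms(2) show ?thesis
    by (auto simp: predS_def dest: transD antisymD)
qed

lemma Restr_underS_predS:
  assumes "is_tree T R" and "s \<in> predS R t"
  shows "Restr (Restr R (predS R t)) (underS (Restr R (predS R t)) s) = Restr R (predS R s)"
proof -
  have "underS (Restr R (predS R t)) s = predS R s"
    using predS_subset[of T R s t] assms by (auto simp: underS_def predS_def)
  then show ?thesis
    using predS_subset[of T R s t] assms by (auto simp: predS_def)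
qed

lemma Field_Restr_predS:
  assumes "is_tree T R"
  shows "Field (Restr R (predS R t)) = predS R t"
proof -
  have "refl_on T R" "R \<subseteq> T \<times> T"
    using assms by (auto simp: is_tree_def dest: partial_order_onD)
  then have "(s, s) \<in> Restr R (predS R t)" if "s \<in> predS R t" for s
    using that by (auto simp: predS_def refl_on_def)
  then show ?thesis
    by (auto simp: Field_def)
qed

lemma Restr_underS_underS:
  assumes "Well_order r" and "a \<in> underS r b"
  shows "Restr (Restr r (underS r b)) (underS (Restr r (underS r b)) a) = Restr r (underS r a)"
    and "a \<in> Field (Restr r (underS r b))"
proof -
  have r: "trans r" "antisym r" "refl_on (Field r) r"
    using assms(1) by (auto simp: order_on_defs)
  then have "underS r a \<subseteq> underS r b"
    using assms(2) by (auto simp: underS_def dest: transD antisymD)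
  moreover have "underS (Restr r (underS r b)) a = underS r a"
    using assms(2) calculation by (auto simp: underS_def)
  ultimately show "Restr (Restr r (underS r b)) (underS (Restr r (underS r b)) a) = Restr r (underS r a)"
    by auto
  have "(a, a) \<in> r"
    using r assms(2) by (auto simp: underS_def refl_on_def Field_def)
  with assms(2) show "a \<in> Field (Restr r (underS r b))"
    by (auto simp: Field_def)
qed

lemma Restr_underS_ordLess:
  assumes "Well_order r" and "a \<in> underS r b"
  shows "Restr r (underS r a) <o Restr r (underS r b)"
proof -
  have "Restr (Restr r (underS r b)) (underS (Restr r (underS r b)) a) <o Restr r (underS r b)"
    using Restr_underS_underS(2)[OF assms] Well_order_Restr[OF assms(1)]
    by (intro underS_Restr_ordLess) auto
  then show ?thesis
    by (simp only: Restr_underS_underS(1)[OF assms])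
qed

text \<open>The predecessors of \<open>t\<close> have order type \<open>d\<close>, so the proper
  initial segment of type \<open>a\<close> is cut off by one of them, and that node lies on level
  \<open>a\<close>.\<close>

lemma ex_predS_tree_level:
  assumes "Well_order r" and tree: "is_tree T R"
    and t: "t \<in> tree_level T R r d" and a: "a \<in> underS r d"
  shows "\<exists>s. s \<in> tree_level T R r a \<and> s \<in> predS R t"
proof -
  let ?W = "Restr R (predS R t)"
  have W: "Well_order ?W" "?W =o Restr r (underS r d)"
    using tree t by (auto simp: is_tree_def tree_level_def)
  then have "Restr r (underS r a) <o ?W"
    using Restr_underS_ordLess[OF assms(1) a] ordIso_symmetric ordLess_ordIso_trans by blast
  then obtain s where s: "s \<in> Field ?W" "Restr r (underS r a) =o Restr ?W (underS ?W s)"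
    using ordLess_iff_ordIso_Restr[OF W(1) Well_order_Restr[OF assms(1)]] by blast
  have "s \<in> predS R t"
    using s(1) Field_Restr_predS[OF tree] by simp
  moreover have "s \<in> T"
    using calculation tree by (auto simp: is_tree_def predS_def dest: partial_order_onD)
  moreover have "Restr R (predS R s) =o Restr r (underS r a)"
    using s(2) Restr_underS_predS[OF tree calculation(1)] ordIso_symmetric by metis
  ultimately show ?thesis
    by (auto simp: tree_level_def)
qed

text \<open>The predecessors of \<open>t\<close> are totally ordered. Were \<open>q\<close> below
  \<open>p\<close>, its predecessors would have smaller order type than those of \<open>p\<close>,
  against \<open>a < b\<close>.\<close>

lemma predS_of_common_bound:
  assumes "Well_order r" and tree: "is_tree T R"
    and p: "p \<in> tree_level T R r a" "p \<in> predS R t"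
    and q: "q \<in> tree_level T R r b" "q \<in> predS R t"
    and ab: "a \<in> underS r b"
  shows "p \<in> predS R q"
proof (rule ccontr)
  assume not: "p \<notin> predS R q"
  have less: "Restr R (predS R p) <o Restr R (predS R q)"
    using Restr_underS_ordLess[OF assms(1) ab] p(1) q(1)
    unfolding tree_level_def mem_Collect_eq
    using ordIso_symmetric ordIso_ordLess_trans ordLess_ordIso_trans by blast
  then have "p \<noteq> q"
    using ordLess_irreflexive by blast
  have wo: "Well_order (Restr R (predS R s))" if "s \<in> T" for s
    using tree that by (auto simp: is_tree_def)
  have "t \<in> T"
    using tree p by (auto simp: is_tree_def predS_def dest: partial_order_onD)
  then have "Total (Restr R (predS R t))"
    using wo by (simp add: order_on_defs)
  then have "(p, q) \<in> R \<or> (q, p) \<in> R"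
    using p(2) q(2) \<open>p \<noteq> q\<close> Field_Restr_predS[OF tree] by (auto simp: total_on_def)
  then have qp: "q \<in> predS R p"
    using not \<open>p \<noteq> q\<close> by (auto simp: predS_def)
  have "Restr R (predS R q) <o Restr R (predS R p)"
  proof -
    have "p \<in> T"
      using p(1) by (simp add: tree_level_def)
    then have "Restr (Restr R (predS R p)) (underS (Restr R (predS R p)) q) <o Restr R (predS R p)"
      using wo qp Field_Restr_predS[OF tree] by (intro underS_Restr_ordLess) auto
    then show ?thesis
      by (simp only: Restr_underS_predS[OF tree qp])
  qed
  then show False
    using less ordLess_irreflexive ordLess_transitive by blast
qed

lemma predS_trans:
  assumes "is_tree T R" and "x \<in> predS R y" and "y \<in> predS R z"
  shows "x \<in> predS R z"
  using predS_subset[of T R y z] assms by (auto simp: predS_def)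

section \<open>Indecomposable ultrafilters\<close>

lemma countable_iff_ordLeq_natLeq: "countable A \<longleftrightarrow> |A| \<le>o natLeq"
proof -
  have "countable A \<longleftrightarrow> |A| \<le>o |UNIV :: nat set|"
    unfolding countable_def by (simp flip: card_of_ordLeq)
  then show ?thesis
    using card_of_nat ordIso_symmetric ordLeq_ordIso_trans by blast
qed

lemma ex_minimal_card:
  assumes "I \<noteq> {}"
  shows "\<exists>i\<in>I. \<forall>j\<in>I. |F i| \<le>o |F j|"
proof -
  have "\<exists>p\<in>(\<lambda>i. |F i| ) ` I. \<forall>q\<in>(\<lambda>i. |F i| ) ` I. p \<le>o q"
    using assms by (intro exists_minim_Well_order) (auto intro: card_of_Well_order)
  then show ?thesis
    by simp
qed

lemma infinite_Field_cardSuc_natLeq: "infinite (Field (cardSuc natLeq))"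
  using cardSuc_finite[OF natLeq_Card_order] Field_natLeq by simp

text \<open>The field of \<open>cardSuc natLeq\<close> has size aleph_1, so \<open>large\<close>
  says that 2^aleph_1 is below kappa.\<close>

locale indecomposable_ultrafilter =
  fixes r :: "'k rel" and U :: "'k set set"
  assumes card: "Card_order r"
    and large: "|Pow (Field (cardSuc natLeq))| <o r"
    and uniform: "uniform_uf r U"
    and indec: "indecomposable_uf r U"
begin

lemma wo: "Well_order r"
  using card by (simp add: card_order_on_def)

lemma uf: "ultrafilter_on (Field r) U"
  using uniform by (simp add: uniform_uf_def)

lemma U_subset: "X \<in> U \<Longrightarrow> X \<subseteq> Field r"
  using uf by (auto simp: ultrafilter_on_def)

lemma U_Int: "X \<in> U \<Longrightarrow> Y \<in> U \<Longrightarrow> X \<inter> Y \<in> U"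
  using uf by (auto simp: ultrafilter_on_def)

lemma U_mono: "X \<in> U \<Longrightarrow> X \<subseteq> Y \<Longrightarrow> Y \<subseteq> Field r \<Longrightarrow> Y \<in> U"
  using uf by (auto simp: ultrafilter_on_def)

lemma U_Field: "Field r \<in> U"
  using uf by (auto simp: ultrafilter_on_def)

lemma U_compl: "X \<subseteq> Field r \<Longrightarrow> X \<notin> U \<Longrightarrow> Field r - X \<in> U"
  using uf unfolding ultrafilter_on_def by blast

lemma U_nonempty: "X \<in> U \<Longrightarrow> X \<noteq> {}"
  using uf by (auto simp: ultrafilter_on_def)

lemma infinite_Field: "infinite (Field r)"
proof -
  have "infinite (Pow (Field (cardSuc natLeq)))"
    using infinite_Field_cardSuc_natLeq by simp
  moreover have "|Pow (Field (cardSuc natLeq))| \<le>o |Field r|"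
    using large card card_of_Field_ordIso ordIso_symmetric ordLess_imp_ordLeq ordLeq_ordIso_trans
    by blast
  ultimately show ?thesis
    using card_of_ordLeq_finite by blast
qed

lemma ex_underS: "a \<in> Field r \<Longrightarrow> \<exists>b\<in>Field r. a \<in> underS r b"
  using infinite_Card_order_limit[OF card infinite_Field] by (auto simp: underS_def)

lemma total: "a \<in> Field r \<Longrightarrow> b \<in> Field r \<Longrightarrow> a = b \<or> a \<in> underS r b \<or> b \<in> underS r a"
  using wo by (auto simp: order_on_defs total_on_def underS_def)

lemma underS_trans: "a \<in> underS r b \<Longrightarrow> b \<in> underS r c \<Longrightarrow> a \<in> underS r c"
  using wo by (auto simp: order_on_defs underS_def dest: transD antisymD)

text \<open>The complement lies in a proper initial segment, which has fewer than kappa elements,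
  contrary to uniformity.\<close>

lemma above_in_U:
  assumes "a \<in> Field r"
  shows "{b \<in> Field r. a \<in> underS r b} \<in> U"
proof (rule ccontr)
  let ?X = "{b \<in> Field r. a \<in> underS r b}"
  assume "?X \<notin> U"
  then have "Field r - ?X \<in> U"
    by (intro U_compl) auto
  then have "|Field r - ?X| =o r"
    using uniform unfolding uniform_uf_def by blast
  moreover obtain c where c: "c \<in> Field r" "a \<in> underS r c"
    using ex_underS assms by blast
  then have "Field r - ?X \<subseteq> underS r c"
    using total[OF assms] underS_trans by blast
  then have "|Field r - ?X| \<le>o |underS r c|"
    by (rule card_of_mono1)
  ultimately show False
    using card_of_underS[OF card c(1)] ordIso_symmetric ordIso_ordLeq_trans ordLeq_ordLess_trans
      ordLess_irreflexive by blast
qed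

text \<open>Choose \<open>A\<close> in \<open>U\<close> whose image under \<open>f\<close> has least
  size. Were the image uncountable, indecomposability at that size would give a member of
  \<open>U\<close> with a smaller image.\<close>

lemma ex_countable_image:
  assumes "|f ` Field r| <o r"
  shows "\<exists>A\<in>U. countable (f ` A)"
proof -
  have "U \<noteq> {}"
    using U_Field by blast
  from ex_minimal_card[OF this] obtain A
    where A: "A \<in> U" and min: "\<forall>B\<in>U. |f ` A| \<le>o |f ` B|"
    by (rule bexE)
  have "countable (f ` A)"
  proof (rule ccontr)
    assume "uncountable (f ` A)"
    then have "natLeq <o |f ` A|"
      by (simp add: countable_iff_ordLeq_natLeq not_ordLeq_iff_ordLess card_of_Well_order
          natLeq_Well_order)
    then have big: "cardSuc natLeq \<le>o |f ` A|"
      by (rule cardSuc_least[OF natLeq_Card_order card_of_Card_order])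
    have "|f ` A| \<le>o |f ` Field r|"
      using U_subset[OF A] by (intro card_of_mono1) blast
    then have small: "|f ` A| <o r"
      using assms ordLeq_ordLess_trans by blast
    \<comment> \<open>\<open>indecomposable_uf\<close> speaks of subsets of \<open>Field r\<close>,
      so the image is copied to such a set \<open>M\<close>.\<close>
    from ordLess_imp_ordLeq[OF this] obtain M where M: "M \<subseteq> Field r" "|f ` A| =o |M|"
      unfolding internalize_card_of_ordLeq[of "f ` A" r] by auto
    then obtain e where e: "bij_betw e (f ` A) M"
      by (auto simp flip: card_of_ordIso)
    obtain a where a: "a \<in> A"
      using U_nonempty[OF A] by blast
    \<comment> \<open>Off \<open>A\<close> the value at \<open>a\<close> is repeated, so that
      \<open>h\<close> maps all of \<open>Field r\<close> into \<open>M\<close>.\<close>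
    define h where "h x = e (f (if x \<in> A then x else a))" for x
    have "h ` Field r \<subseteq> M"
      using e a by (auto simp: h_def bij_betw_def)
    moreover have "indecomposable_for r U M"
    proof -
      have "cardSuc natLeq \<le>o |M|" "|M| <o r"
        using ordLeq_ordIso_trans[OF big M(2)] ordIso_ordLess_trans[OF ordIso_symmetric[OF M(2)] small]
        by blast+
      then show ?thesis
        using indec M(1) by (auto simp: indecomposable_uf_def)
    qed
    ultimately obtain H where H: "|H| <o |M|" "{x \<in> Field r. h x \<in> H} \<in> U"
      unfolding indecomposable_for_def by blast
    define B where "B = {x \<in> Field r. h x \<in> H} \<inter> A"
    have "B \<in> U"
      using H(2) A U_Int by (simp add: B_def)
    have "|f ` B| \<le>o |H|"
    proof (rule card_of_ordLeqI)
      show "inj_on e (f ` B)"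
        using e by (auto simp: bij_betw_def B_def intro: inj_on_subset)
      show "e y \<in> H" if "y \<in> f ` B" for y
        using that by (auto simp: B_def h_def)
    qed
    also note H(1)
    also have "|M| =o |f ` A|"
      using M(2) ordIso_symmetric by blast
    also have "|f ` A| \<le>o |f ` B|"
      using min \<open>B \<in> U\<close> by (rule bspec)
    finally show False
      using ordLess_irreflexive by blast
  qed
  with A show ?thesis
    by blast
qed

section \<open>Families of size at most 2^aleph_1\<close>

lemma ordLess_of_subset_Pow:
  assumes "X \<subseteq> Pow (Field (cardSuc natLeq) \<times> (UNIV :: nat set))"
  shows "|X| <o r"
proof -
  let ?W = "Field (cardSuc natLeq)"
  \<comment> \<open>The product of aleph_1 and aleph_0 is aleph_1, so subsets of the product are
    coded by subsets of omega_1.\<close>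
  have "|UNIV :: nat set| \<le>o |?W|"
    using infinite_Field_cardSuc_natLeq infinite_iff_card_of_nat by blast
  then have "|?W \<times> (UNIV :: nat set)| =o |?W|"
    using card_of_Times_infinite[OF infinite_Field_cardSuc_natLeq] by blast
  then have "|?W \<times> (UNIV :: nat set)| \<le>o |?W|"
    by (rule ordIso_imp_ordLeq)
  then obtain e where e: "inj_on e (?W \<times> (UNIV :: nat set))" "e ` (?W \<times> UNIV) \<subseteq> ?W"
    by (auto simp flip: card_of_ordLeq)
  have "|X| \<le>o |Pow ?W|"
  proof (rule card_of_ordLeqI[of "image e"])
    show "inj_on ((`) e) X"
      using inj_on_image_Pow[OF e(1)] assms inj_on_subset by blast
    show "e ` s \<in> Pow ?W" if "s \<in> X" for s
      using that assms e(2) by blast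
  qed
  then show ?thesis
    using large ordLeq_ordLess_trans by blast
qed

text \<open>Embedding the first coordinate into omega_1 turns a relation on omega into a subset of
  omega_1 times omega.\<close>

lemma ordLess_of_nat_relations: "|X :: (nat \<times> nat) set set| <o r"
proof -
  have "|UNIV :: nat set| \<le>o |Field (cardSuc natLeq)|"
    using infinite_Field_cardSuc_natLeq infinite_iff_card_of_nat by blast
  then obtain e :: "nat \<Rightarrow> nat set" where e: "inj e" "range e \<subseteq> Field (cardSuc natLeq)"
    by (auto simp flip: card_of_ordLeq)
  have "inj (map_prod e (id :: nat \<Rightarrow> nat))"
    using e(1) by (intro prod.inj_map) auto
  then have "inj_on ((`) (map_prod e (id :: nat \<Rightarrow> nat))) X"
    using inj_on_image_Pow inj_on_subset by blast
  then have "|X| \<le>o |(`) (map_prod e id) ` X|"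
    by (intro card_of_ordLeqI[of "(`) (map_prod e id)"]) auto
  moreover have "|(`) (map_prod e id) ` X| <o r"
    using e(2) by (intro ordLess_of_subset_Pow) auto
  ultimately show ?thesis
    using ordLeq_ordLess_trans by blast
qed

lemma ordLess_of_nat_sets: "|X :: nat set set| <o r"
proof -
  have "|X| \<le>o |(\<lambda>s. s \<times> {0 :: nat}) ` X|"
    by (intro card_of_ordLeqI[of "\<lambda>s. s \<times> {0 :: nat}"]) (auto simp: inj_on_def)
  then show ?thesis
    using ordLess_of_nat_relations ordLeq_ordLess_trans by blast
qed

lemma ordLess_of_nat_set_sequences: "|X :: (nat \<Rightarrow> nat set) set| <o r"
proof -
  have "inj_on (\<lambda>f :: nat \<Rightarrow> nat set. Sigma UNIV f) X"
    by (auto simp: inj_on_def fun_eq_iff)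
  then have "|X| \<le>o |Sigma UNIV ` X|"
    by (intro card_of_ordLeqI[of "Sigma UNIV"]) auto
  then show ?thesis
    using ordLess_of_nat_relations ordLeq_ordLess_trans by blast
qed

text \<open>Modulo \<open>U\<close>, the partition into fibres of \<open>\<phi>\<close> refines
  every partition of kappa into countably many pieces.\<close>

definition finest :: "('k \<Rightarrow> nat) \<Rightarrow> bool" where
  "finest \<phi> \<longleftrightarrow> (\<forall>g :: 'k \<Rightarrow> nat. \<exists>A\<in>U. \<forall>x\<in>A. \<forall>y\<in>A. \<phi> x = \<phi> y \<longrightarrow> g x = g y)"

lemma not_finest:
  "\<not> finest \<phi> \<Longrightarrow> \<exists>g :: 'k \<Rightarrow> nat. \<forall>A\<in>U. \<exists>x\<in>A. \<exists>y\<in>A. \<phi> x = \<phi> y \<and> g x \<noteq> g y"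
  by (simp add: finest_def)

text \<open>
  Otherwise choose maps \<open>F a\<close> to \<open>\<omega>\<close>, for \<open>a < \<omega>\<^sub>1\<close>, none of which factors through the earlier ones
  modulo \<open>U\<close>. Their product \<open>G\<close> has at most \<open>2\<^sup>\<aleph>\<^sup>1\<close> values, hence only countably many on a set in \<open>U\<close>.
  Countably many sequences of length \<open>\<omega>\<^sub>1\<close> differ pairwise below some \<open>a' < \<omega>\<^sub>1\<close>, so that \<open>F a'\<close> does
  factor through the earlier maps.
\<close>
lemma ex_finest: "\<exists>\<phi>. finest \<phi>"
proof (rule ccontr)
  assume no: "\<nexists>\<phi>. finest \<phi>"
  define w :: "nat set rel" where "w = cardSuc natLeq"
  have w: "Card_order w" "regularCard w" "Well_order w"
    using cardSuc_Card_order[OF natLeq_Card_order] infinite_cardSuc_regularCard[OF _ natLeq_Card_order]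
      Field_natLeq cardSuc_Well_order[OF natLeq_Card_order] by (auto simp: w_def)
  define P where "P F a g \<longleftrightarrow>
    (\<forall>A\<in>U. \<exists>x\<in>A. \<exists>y\<in>A. (\<forall>b\<in>underS w a. F b x = F b y) \<and> g x \<noteq> g y)"
    for F :: "nat set \<Rightarrow> 'k \<Rightarrow> nat" and a and g :: "'k \<Rightarrow> nat"
  have "\<exists>F. \<forall>a. P F a (F a)"
  proof (rule dependent_wf_choice)
    show "wf (w - Id)"
      using w(3) by (simp add: well_order_on_def)
  next
    fix F G :: "nat set \<Rightarrow> 'k \<Rightarrow> nat" and a g
    assume "\<And>b. (b, a) \<in> w - Id \<Longrightarrow> F b = G b"
    then have "F b = G b" if "b \<in> underS w a" for b
      using that by (auto simp: underS_def)
    then show "P F a g = P G a g"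
      by (simp add: P_def)
  next
    fix F :: "nat set \<Rightarrow> 'k \<Rightarrow> nat" and a
    define Fa where "Fa x = (SIGMA b:underS w a. {F b x})" for x
    have "|Fa ` Field r| <o r"
      by (intro ordLess_of_subset_Pow) (auto simp: Fa_def underS_def Field_def w_def)
    then obtain A where A: "A \<in> U" "countable (Fa ` A)"
      using ex_countable_image by blast
    \<comment> \<open>The tuple of the earlier maps has countably many values on \<open>A\<close>.
      Numbering them gives a map to omega that is not finest, and a witness of this is the next
      map.\<close>
    have "\<not> finest (\<lambda>x. to_nat_on (Fa ` A) (Fa x))"
      using no by blast
    from not_finest[OF this] obtain g :: "'k \<Rightarrow> nat" where
      g: "\<forall>B\<in>U. \<exists>x\<in>B. \<exists>y\<in>B. to_nat_on (Fa ` A) (Fa x) = to_nat_on (Fa ` A) (Fa y) \<and> g x \<noteq> g y" ..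
    have "\<exists>x\<in>B. \<exists>y\<in>B. (\<forall>b\<in>underS w a. F b x = F b y) \<and> g x \<noteq> g y" if B: "B \<in> U" for B
    proof -
      obtain x y where xy: "x \<in> B \<inter> A" "y \<in> B \<inter> A"
        "to_nat_on (Fa ` A) (Fa x) = to_nat_on (Fa ` A) (Fa y)" "g x \<noteq> g y"
        using bspec[OF g U_Int[OF B A(1)]] by blast
      then have "Fa x = Fa y"
        by (subst (asm) to_nat_on_inj[OF A(2)]) auto
      then have "\<forall>b\<in>underS w a. F b x = F b y"
        by (auto simp: Fa_def)
      with xy show ?thesis
        by blast
    qed
    then have "P F a g"
      by (simp add: P_def)
    then show "\<exists>g. P F a g"
      by (rule exI[of _ g])
  qed
  then obtain F where F: "\<forall>a. P F a (F a)" ..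
  define G where "G x = (SIGMA b:Field w. {F b x})" for x
  have "|G ` Field r| <o r"
    by (intro ordLess_of_subset_Pow) (auto simp: G_def w_def)
  then obtain A where A: "A \<in> U" "countable (G ` A)"
    using ex_countable_image by blast
  \<comment> \<open>The choice depends only on the two values of \<open>G\<close>, so countably many
    values yield countably many indices. These values are graphs of functions with the same domain,
    so if they differ then \<open>fst p - snd p\<close> is nonempty.\<close>
  define diff where "diff p = (SOME b. b \<in> Field w \<and> ((\<exists>n. (b, n) \<in> fst p - snd p)))"
    for p :: "(nat set \<times> nat) set \<times> (nat set \<times> nat) set"
  have diff: "diff (G x, G y) \<in> Field w \<and> F (diff (G x, G y)) x \<noteq> F (diff (G x, G y)) y"
    if "G x \<noteq> G y" for x y
  proof -
    have "\<exists>b. b \<in> Field w \<and> (\<exists>n. (b, n) \<in> G x - G y)"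
      using that by (auto simp: G_def)
    from someI_ex[OF this] show ?thesis
      unfolding diff_def by (auto simp: G_def)
  qed
  \<comment> \<open>For equal graphs \<open>diff\<close> is arbitrary, hence the intersection with
    \<open>Field w\<close>.\<close>
  define K where "K = diff ` (G ` A \<times> G ` A) \<inter> Field w"
  have "countable K"
    using A(2) by (auto simp: K_def)
  then have "|K| <o w"
    using countable_iff_ordLeq_natLeq cardSuc_greater[OF natLeq_Card_order] ordLeq_ordLess_trans
    unfolding w_def by blast
  moreover have "K \<subseteq> Field w"
    by (simp add: K_def)
  ultimately have "\<not> cofinal K w"
    using w(2) not_ordLess_ordIso unfolding regularCard_def by metis
  then obtain a where a: "a \<in> Field w" "\<And>b. b \<in> K \<Longrightarrow> a = b \<or> (a, b) \<notin> w"
    unfolding cofinal_def by blast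
  have "infinite (Field w)"
    using infinite_Field_cardSuc_natLeq by (simp add: w_def)
  \<comment> \<open>The elements of \<open>K\<close> are at most \<open>a\<close>; a larger
    \<open>a'\<close> is strictly above them.\<close>
  then obtain a' where a': "a' \<in> Field w" "a \<noteq> a'" "(a, a') \<in> w"
    using infinite_Card_order_limit[OF w(1) _ a(1)] by blast
  have K: "b \<in> underS w a'" if "b \<in> K" for b
  proof -
    have "b = a \<or> (b, a) \<in> w"
      using a(1) a(2)[OF that] \<open>K \<subseteq> Field w\<close> that w(3)
      by (auto simp: order_on_defs total_on_def)
    then show ?thesis
      using a' w(3) by (auto simp: underS_def order_on_defs dest: transD antisymD)
  qed
  have "\<exists>x\<in>A. \<exists>y\<in>A. (\<forall>b\<in>underS w a'. F b x = F b y) \<and> F a' x \<noteq> F a' y"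
    using spec[OF F, of a'] A(1) by (simp add: P_def)
  then obtain x y where xy: "x \<in> A" "y \<in> A" "\<forall>b\<in>underS w a'. F b x = F b y" "F a' x \<noteq> F a' y"
    by (elim bexE conjE) (rule that)
  have "G x \<noteq> G y"
    using xy(4) a'(1) by (auto simp: G_def)
  then have "diff (G x, G y) \<in> K" "F (diff (G x, G y)) x \<noteq> F (diff (G x, G y)) y"
    using diff xy(1,2) by (auto simp: K_def)
  then show False
    using K xy(3) by blast
qed

text \<open>On a set in \<open>U\<close> the map \<open>f\<close> has countably many values.
  Numbering them gives a map to omega, to which \<open>finest\<close> applies.\<close>

lemma finest_factor:
  assumes "finest \<phi>" and "|f ` Field r| <o r"
  shows "\<exists>g. range g \<subseteq> f ` Field r \<and> {x \<in> Field r. f x = g (\<phi> x)} \<in> U"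
proof -
  obtain A where A: "A \<in> U" "countable (f ` A)"
    using ex_countable_image assms(2) by blast
  obtain B where B: "B \<in> U"
    "\<And>x y. x \<in> B \<Longrightarrow> y \<in> B \<Longrightarrow> \<phi> x = \<phi> y \<Longrightarrow> to_nat_on (f ` A) (f x) = to_nat_on (f ` A) (f y)"
    using assms(1) unfolding finest_def by meson
  define C where "C = A \<inter> B"
  have C: "C \<in> U"
    using A(1) B(1) U_Int by (simp add: C_def)
  obtain c where "c \<in> C"
    using U_nonempty[OF C] by blast
  have f: "f x = f y" if "x \<in> C" "y \<in> C" "\<phi> x = \<phi> y" for x y
    using that B(2)[of x y] to_nat_on_inj[OF A(2)] by (auto simp: C_def)
  \<comment> \<open>\<open>s\<close> picks a representative of each fibre; the default
    \<open>c\<close> keeps the range of the factor inside the image of \<open>f\<close>.\<close>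
  define s where "s n = (if n \<in> \<phi> ` C then inv_into C \<phi> n else c)" for n
  have s: "s n \<in> C" for n
    using \<open>c \<in> C\<close> by (auto simp: s_def inv_into_into)
  have "f x = f (s (\<phi> x))" if "x \<in> C" for x
    using f[OF that s[of "\<phi> x"]] that by (simp add: s_def f_inv_into_f)
  then have "C \<subseteq> {x \<in> Field r. f x = f (s (\<phi> x))}"
    using U_subset[OF C] by blast
  then have "{x \<in> Field r. f x = f (s (\<phi> x))} \<in> U"
    using C U_mono by blast
  moreover have "range (\<lambda>n. f (s n)) \<subseteq> f ` Field r"
    using s U_subset[OF C] by blast
  ultimately show ?thesis
    by blast
qed

end

text \<open>Otherwise every fibre is bounded, and the bounds, fewer than kappa many, are cofinal,
  contrary to regularity.\<close>

lemma regularCard_ex_unbounded_fiber: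
  assumes r: "Card_order r" "regularCard r" "infinite (Field r)" and "|f ` Field r| <o r"
  shows "\<exists>y. \<forall>a\<in>Field r. \<exists>b\<in>Field r. f b = y \<and> a \<in> underS r b"
proof (rule ccontr)
  assume "\<not> ?thesis"
  then obtain bd where bd: "\<And>y. bd y \<in> Field r" "\<And>y b. b \<in> Field r \<Longrightarrow> f b = y \<Longrightarrow> bd y \<notin> underS r b"
    by metis
  have wo: "Well_order r"
    using r(1) by (simp add: card_order_on_def)
  have "cofinal (bd ` f ` Field r) r"
    unfolding cofinal_def
  proof
    fix a assume "a \<in> Field r"
    then obtain b where b: "b \<in> Field r" "a \<noteq> b" "(a, b) \<in> r"
      using infinite_Card_order_limit[OF r(1,3)] by blast
    then have "b = bd (f b) \<or> (b, bd (f b)) \<in> r"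
      using bd(1)[of "f b"] bd(2)[of b "f b"] wo by (auto simp: order_on_defs total_on_def underS_def)
    then have "a \<noteq> bd (f b) \<and> (a, bd (f b)) \<in> r"
      using b wo by (auto simp: order_on_defs dest: transD antisymD)
    then show "\<exists>c\<in>bd ` f ` Field r. a \<noteq> c \<and> (a, c) \<in> r"
      using b(1) by blast
  qed
  moreover have "bd ` f ` Field r \<subseteq> Field r"
    using bd(1) by blast
  ultimately have "|bd ` f ` Field r| =o r"
    using r(2) unfolding regularCard_def by blast
  moreover have "|bd ` f ` Field r| <o r"
    using card_of_image assms(4) ordLeq_ordLess_trans by blast
  ultimately show False
    using ordLess_irreflexive ordIso_symmetric ordIso_ordLess_trans by blast
qed

section \<open>Ascent paths\<close>

context indecomposable_ultrafilter
begin

text \<open>For almost all \<open>x\<close> the nodes \<open>g a (\<phi> x)\<close> and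
  \<open>g b (\<phi> x)\<close> both lie below one node \<open>t x\<close>, hence they are ordered
  as their levels are.\<close>

lemma ex_ultrafilter_ascent_path:
  assumes tree: "is_tree T R" and "finest \<phi>"
    and nonempty: "\<And>a. a \<in> Field r \<Longrightarrow> tree_level T R r a \<noteq> {}"
    and narrow: "\<And>a. a \<in> Field r \<Longrightarrow> |tree_level T R r a| <o r"
  obtains g where "\<And>a i. a \<in> Field r \<Longrightarrow> g a i \<in> tree_level T R r a"
    and "\<And>a b. b \<in> Field r \<Longrightarrow> a \<in> underS r b \<Longrightarrow> {x \<in> Field r. g a (\<phi> x) \<in> predS R (g b (\<phi> x))} \<in> U"
proof -
  define t where "t a = (SOME s. s \<in> tree_level T R r a)" for a
  have t: "t a \<in> tree_level T R r a" if "a \<in> Field r" for a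
    using nonempty[OF that] by (simp add: t_def some_in_eq)
  have "\<exists>s. s \<in> tree_level T R r a \<and> s \<in> predS R (t x)" if "a \<in> underS r x" for a x
  proof -
    have "x \<in> Field r"
      using that by (auto simp: underS_def Field_def)
    then show ?thesis
      using ex_predS_tree_level[OF wo tree t that] by blast
  qed
  then obtain p where p: "\<And>a x. a \<in> underS r x \<Longrightarrow> p a x \<in> tree_level T R r a \<and> p a x \<in> predS R (t x)"
    by metis
  \<comment> \<open>The default \<open>t a\<close> keeps every value on level \<open>a\<close>; it
    is used only for \<open>x\<close> not above \<open>a\<close>, a set outside
    \<open>U\<close>.\<close>
  define h where "h a x = (if a \<in> underS r x then p a x else t a)" for a x
  have h: "h a ` Field r \<subseteq> tree_level T R r a" if "a \<in> Field r" for a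
    using p t that by (auto simp: h_def)
  have "\<exists>g. range g \<subseteq> tree_level T R r a \<and> {x \<in> Field r. h a x = g (\<phi> x)} \<in> U"
    if a: "a \<in> Field r" for a
  proof -
    have "|h a ` Field r| <o r"
      using card_of_mono1[OF h[OF a]] narrow[OF a] ordLeq_ordLess_trans by blast
    from finest_factor[OF assms(2) this] h[OF a] show ?thesis
      by (elim exE conjE) (intro exI conjI, rule subset_trans)
  qed
  then obtain g where g: "\<And>a. a \<in> Field r \<Longrightarrow> range (g a) \<subseteq> tree_level T R r a"
    "\<And>a. a \<in> Field r \<Longrightarrow> {x \<in> Field r. h a x = g a (\<phi> x)} \<in> U"
    by metis
  show ?thesis
  proof
    show "g a i \<in> tree_level T R r a" if "a \<in> Field r" for a i
      using g(1)[OF that] by blast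
  next
    fix a b assume b: "b \<in> Field r" and ab: "a \<in> underS r b"
    then have a: "a \<in> Field r"
      by (auto simp: underS_def Field_def)
    let ?A = "{x \<in> Field r. h a x = g a (\<phi> x)} \<inter> {x \<in> Field r. h b x = g b (\<phi> x)}
      \<inter> {x \<in> Field r. b \<in> underS r x}"
    have "?A \<in> U"
      using g(2)[OF a] g(2)[OF b] above_in_U[OF b] U_Int by blast
    moreover have "?A \<subseteq> {x \<in> Field r. g a (\<phi> x) \<in> predS R (g b (\<phi> x))}"
    proof
      fix x assume x: "x \<in> ?A"
      then have "b \<in> underS r x" "a \<in> underS r x"
        using underS_trans[OF ab] by auto
      moreover have "p a x \<in> predS R (p b x)"
        using calculation p predS_of_common_bound[OF wo tree _ _ _ _ ab] by metis
      ultimately have "g a (\<phi> x) \<in> predS R (g b (\<phi> x))"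
        using x by (auto simp: h_def)
      then show "x \<in> {x \<in> Field r. g a (\<phi> x) \<in> predS R (g b (\<phi> x))}"
        using x by simp
    qed
    ultimately show "{x \<in> Field r. g a (\<phi> x) \<in> predS R (g b (\<phi> x))} \<in> U"
      using U_mono by blast
  qed
qed

text \<open>The ultrafilter is replaced by the cofinite filter, at the price of passing to an
  unbounded set \<open>D\<close> of levels and a sequence \<open>y\<close> of indices.\<close>

lemma ex_nodes_below_sequence:
  assumes tree: "is_tree T R" and "finest \<phi>" and "regularCard r"
    and g: "\<And>a i. a \<in> Field r \<Longrightarrow> g a i \<in> tree_level T R r a"
      "\<And>a b. b \<in> Field r \<Longrightarrow> a \<in> underS r b \<Longrightarrow> {x \<in> Field r. g a (\<phi> x) \<in> predS R (g b (\<phi> x))} \<in> U"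
  obtains D and y :: "nat \<Rightarrow> nat" where "D \<subseteq> Field r"
    and "\<And>a. a \<in> Field r \<Longrightarrow> \<exists>d\<in>D. a \<in> underS r d"
    and "\<And>a b. a \<in> D \<Longrightarrow> b \<in> D \<Longrightarrow> a \<in> underS r b \<Longrightarrow> \<exists>n. \<forall>m\<ge>n. g a (y m) \<in> predS R (g b (y m))"
proof -
  define W where "W = {X. {x \<in> Field r. \<phi> x \<in> X} \<in> U}"
  have W_Int: "X \<inter> Y \<in> W" if "X \<in> W" "Y \<in> W" for X Y
  proof -
    have "{x \<in> Field r. \<phi> x \<in> X \<inter> Y} = {x \<in> Field r. \<phi> x \<in> X} \<inter> {x \<in> Field r. \<phi> x \<in> Y}"
      by blast
    then show ?thesis
      using that U_Int by (simp add: W_def)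
  qed
  have W_nonempty: "X \<noteq> {}" if "X \<in> W" for X
    using that U_nonempty by (auto simp: W_def)
  \<comment> \<open>For \<open>c\<close> not above \<open>a\<close> this set is all of omega, so
    \<open>X a\<close> maps \<open>Field r\<close> into \<open>W\<close>, and every value of its
    factor \<open>Y a\<close> lies in \<open>W\<close>.\<close>
  define X where "X a c = {i. a \<in> underS r c \<longrightarrow> g a i \<in> predS R (g c i)}" for a c
  have X: "X a c \<in> W" if "c \<in> Field r" for a c
    using g(2)[OF that, of a] U_Field by (cases "a \<in> underS r c") (auto simp: X_def W_def)
  have "\<exists>Y. range Y \<subseteq> W \<and> {c \<in> Field r. X a c = Y (\<phi> c)} \<in> U" for a
  proof -
    obtain Y where "range Y \<subseteq> X a ` Field r" "{c \<in> Field r. X a c = Y (\<phi> c)} \<in> U"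
      using finest_factor[OF assms(2) ordLess_of_nat_sets, of "X a"] by (elim exE conjE)
    moreover have "X a ` Field r \<subseteq> W"
      using X by blast
    ultimately show ?thesis
      using subset_trans by blast
  qed
  then obtain Y where Y: "\<And>a. range (Y a) \<subseteq> W" "\<And>a. {c \<in> Field r. X a c = Y a (\<phi> c)} \<in> U"
    by metis
  obtain Z where Z: "\<And>a. a \<in> Field r \<Longrightarrow> \<exists>d\<in>Field r. Y d = Z \<and> a \<in> underS r d"
    using regularCard_ex_unbounded_fiber[OF card assms(3) infinite_Field ordLess_of_nat_set_sequences, of Y]
    by blast
  define D where "D = {d \<in> Field r. Y d = Z}"
  obtain c where "c \<in> Field r"
    using infinite_Field by fastforce
  then have ZW: "Z n \<in> W" for n
    using Z Y(1) by blast
  have "(\<Inter>n\<le>m. Z n) \<in> W" for m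
    by (induction m) (auto simp: atMost_Suc intro: ZW W_Int)
  then have "\<exists>i. i \<in> (\<Inter>n\<le>m. Z n)" for m
    using W_nonempty by blast
  then obtain y where y: "\<And>m. y m \<in> (\<Inter>n\<le>m. Z n)"
    by metis
  show ?thesis
  proof
    show "D \<subseteq> Field r"
      by (auto simp: D_def)
    show "\<exists>d\<in>D. a \<in> underS r d" if "a \<in> Field r" for a
      using Z[OF that] by (auto simp: D_def)
  next
    fix a b assume a: "a \<in> D" and b: "b \<in> D" and ab: "a \<in> underS r b"
    let ?C = "{c \<in> Field r. X a c = Y a (\<phi> c)} \<inter> {c \<in> Field r. X b c = Y b (\<phi> c)}
      \<inter> {c \<in> Field r. b \<in> underS r c}"
    have "?C \<in> U"
      using Y(2)[of a] Y(2)[of b] above_in_U[of b] b U_Int by (auto simp: D_def)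
    then obtain c where c: "c \<in> Field r" "X a c = Z (\<phi> c)" "X b c = Z (\<phi> c)" "b \<in> underS r c"
      using U_nonempty[of ?C] a b by (auto simp: D_def)
    have "g a (y m) \<in> predS R (g b (y m))" if "m \<ge> \<phi> c" for m
    proof -
      have "y m \<in> Z (\<phi> c)"
        using y[of m] that by blast
      then have "g a (y m) \<in> predS R (g c (y m))" "g b (y m) \<in> predS R (g c (y m))"
        using c underS_trans[OF ab c(4)] by (auto simp: X_def)
      then show ?thesis
        using predS_of_common_bound[OF wo tree _ _ _ _ ab] g(1) a b by (auto simp: D_def)
    qed
    then show "\<exists>n. \<forall>m\<ge>n. g a (y m) \<in> predS R (g b (y m))"
      by blast
  qed
qed

text \<open>Let \<open>f a i\<close> be the predecessor on level \<open>a\<close> of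
  \<open>e (d a) i\<close>, for some \<open>d a\<close> in \<open>D\<close> above \<open>a\<close>.
  For almost all \<open>i\<close>, the higher of \<open>e (d a) i\<close> and
  \<open>e (d b) i\<close> bounds both \<open>f a i\<close> and \<open>f b i\<close>.\<close>

lemma ex_omega_ascent_path:
  assumes tree: "is_tree T R" and D: "D \<subseteq> Field r" "\<And>a. a \<in> Field r \<Longrightarrow> \<exists>d\<in>D. a \<in> underS r d"
    and e: "\<And>d i. d \<in> D \<Longrightarrow> e d i \<in> tree_level T R r d"
      "\<And>a b. a \<in> D \<Longrightarrow> b \<in> D \<Longrightarrow> a \<in> underS r b \<Longrightarrow> \<exists>n :: nat. \<forall>m\<ge>n. e a m \<in> predS R (e b m)"
  shows "\<exists>f. omega_ascent_path r T R f"
proof -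
  obtain d where d: "\<And>a. a \<in> Field r \<Longrightarrow> d a \<in> D" "\<And>a. a \<in> Field r \<Longrightarrow> a \<in> underS r (d a)"
    using D(2) by metis
  have "\<forall>a\<in>Field r. \<forall>i. \<exists>s. s \<in> tree_level T R r a \<and> s \<in> predS R (e (d a) i)"
    using ex_predS_tree_level[OF wo tree e(1)] d by blast
  then obtain f where f: "\<And>a i. a \<in> Field r \<Longrightarrow> f a i \<in> tree_level T R r a"
    "\<And>a i. a \<in> Field r \<Longrightarrow> f a i \<in> predS R (e (d a) i)"
    by metis
  have "finite {i. \<not> ((f a i, f b i) \<in> R \<and> f a i \<noteq> f b i)}"
    if a: "a \<in> Field r" and b: "b \<in> Field r" and ab: "(a, b) \<in> r" "a \<noteq> b" for a b
  proof -
    have "\<exists>n. \<forall>m\<ge>n. \<exists>t. f a m \<in> predS R t \<and> f b m \<in> predS R t"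
    proof -
      \<comment> \<open>The choice of \<open>d\<close> need not be monotone, so \<open>d a\<close>
        may be above \<open>d b\<close> although \<open>a < b\<close>.\<close>
      consider "d a = d b" | "d a \<in> underS r (d b)" | "d b \<in> underS r (d a)"
        using total d(1) a b D(1) by blast
      then show ?thesis
      proof cases
        case 1
        then show ?thesis
          using f(2)[OF a] f(2)[OF b] by metis
      next
        case 2
        with e(2) d(1) a b show ?thesis
          using f(2)[OF a] f(2)[OF b] predS_trans[OF tree] by meson
      next
        case 3
        with e(2) d(1) a b show ?thesis
          using f(2)[OF a] f(2)[OF b] predS_trans[OF tree] by meson
      qed
    qed
    then obtain n where n: "\<And>m. m \<ge> n \<Longrightarrow> f a m \<in> predS R (f b m)"
      using predS_of_common_bound[OF wo tree f(1)[OF a] _ f(1)[OF b]] ab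
      by (metis underS_I)
    have "i < n" if "\<not> ((f a i, f b i) \<in> R \<and> f a i \<noteq> f b i)" for i
      using that n[of i] by (auto simp: predS_def not_less[symmetric])
    then have "{i. \<not> ((f a i, f b i) \<in> R \<and> f a i \<noteq> f b i)} \<subseteq> {..<n}"
      by blast
    then show ?thesis
      using finite_subset by blast
  qed
  then have "omega_ascent_path r T R f"
    using f(1) by (auto simp: omega_ascent_path_def)
  then show ?thesis
    by (rule exI[of _ f])
qed

end

theorem theorem4p10:
  fixes r :: "'k rel" and U :: "'k set set"
  assumes "Card_order r" and "regularCard r"
    and "(card_of (Pow (Field (cardSuc natLeq))), r) \<in> ordLess"
    and "uniform_uf r U" and "indecomposable_uf r U"
  shows "\<forall>(T :: 't set) R. aronszajn_tree r T R \<longrightarrow> (\<exists>f. omega_ascent_path r T R f)"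
proof (intro allI impI)
  fix T :: "'t set" and R
  assume "aronszajn_tree r T R"
  then have tree: "is_tree T R" "\<And>a. a \<in> Field r \<Longrightarrow> tree_level T R r a \<noteq> {}"
    "\<And>a. a \<in> Field r \<Longrightarrow> |tree_level T R r a| <o r"
    by (simp_all add: aronszajn_tree_def)
  interpret indecomposable_ultrafilter r U
    using assms by unfold_locales
  obtain \<phi> where \<phi>: "finest \<phi>"
    using ex_finest by blast
  show "\<exists>f. omega_ascent_path r T R f"
  proof (rule ex_ultrafilter_ascent_path[OF tree(1) \<phi> tree(2,3)])
    fix g
    assume g: "\<And>a i. a \<in> Field r \<Longrightarrow> g a i \<in> tree_level T R r a"
      "\<And>a b. b \<in> Field r \<Longrightarrow> a \<in> underS r b \<Longrightarrow> {x \<in> Field r. g a (\<phi> x) \<in> predS R (g b (\<phi> x))} \<in> U"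
    show ?thesis
    proof (rule ex_nodes_below_sequence[OF tree(1) \<phi> assms(2) g])
      fix D and y :: "nat \<Rightarrow> nat"
      assume D: "D \<subseteq> Field r" "\<And>a. a \<in> Field r \<Longrightarrow> \<exists>d\<in>D. a \<in> underS r d"
        "\<And>a b. a \<in> D \<Longrightarrow> b \<in> D \<Longrightarrow> a \<in> underS r b \<Longrightarrow> \<exists>n. \<forall>m\<ge>n. g a (y m) \<in> predS R (g b (y m))"
      show ?thesis
        using g(1) D by (intro ex_omega_ascent_path[OF tree(1), of D "\<lambda>d i. g d (y i)"]) auto
    qed
  qed
qed

end
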